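(* Let $p$ be a prime with $p\equiv 1\pmod 6$. Suppose that $[-1,5]^\ast=\{-1,1,2,3,4,5\}$ splits $\mathbb{Z}_p$ with a splitter set $B$, and let $B_1=B\cap\langle -1,2,3,5\rangle$. Then either $$B_1=\bigcup_{k=0}^{\infty}\varepsilon_k 8^k\left\langle -\tfrac{2}{5},\,-\tfrac{4}{3}\right\rangle$$ for some choice of signs $\varepsilon_k\in\{1,-1\}$ ($k\ge 0$), or $$B_1=\bigcup_{k=0}^{\infty}\varepsilon_k 8^k\left\langle -\tfrac{4}{5},\,-\tfrac{2}{3}\right\rangle$$ for some choice of signs $\varepsilon_k\in\{1,-1\}$ ($k\ge0$).
   Context: All arithmetic is in the field $\mathbb{Z}_p$; $\langle a_1,\ldots,a_r\rangle$ denotes the subgroup of the multiplicative group $\mathbb{Z}_p^\ast$ generated by $a_1,\ldots,a_r$, and for $c\in\mathbb{Z}_p^\ast$ and $T\subseteq \mathbb{Z}_p^\ast$, $cT=\{ct: t\in T\}$. For a set $M$ of integers and $B\subseteq\mathbb{Z}_p$, $M$ splits $\mathbb{Z}_p$ with splitter set $B$ if every nonzero element $g\in\mathbb{Z}_p$ has a unique representation $g=mb$ with $m\in M$, $b\in B$, while $0$ has no such representation.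
   Formalization: As stated this fails (p=7, B={3}: each union contains 1 or -1); the formal theorem gives the two formulas when 1 or -1 lies in B, and for arbitrary B gives B_1 = c times one of the two unions for every c in B_1. *)

theory Defs
  imports "HOL-Number_Theory.Residues" "HOL-Algebra.Multiplicative_Group"
    "HOL-Algebra.Generated_Groups"
begin

text \<open>The field \<open>\<int>\<^sub>p\<close> is \<open>residue_ring (int p)\<close>, with carrier \<open>{0..int p - 1}\<close>.\<close>

abbreviation Zp :: "nat \<Rightarrow> int ring" where
  "Zp p \<equiv> residue_ring (int p)"

abbreviation Zp_units :: "nat \<Rightarrow> int monoid" where
  "Zp_units p \<equiv> mult_of (Zp p)"

definition zp :: "nat \<Rightarrow> int \<Rightarrow> int" where
  "zp p a = a mod int p"

definition zp_frac :: "nat \<Rightarrow> int \<Rightarrow> int \<Rightarrow> int" where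
  "zp_frac p a b = zp p a \<otimes>\<^bsub>Zp p\<^esub> inv\<^bsub>Zp p\<^esub> (zp p b)"

text \<open>In \<open>splits p M B\<close> the elements of \<open>M\<close> are integers, not residue classes, so a
  representation is a pair in \<open>M \<times> B\<close> with \<open>M\<close> unreduced.\<close>

definition splits :: "nat \<Rightarrow> int set \<Rightarrow> int set \<Rightarrow> bool" where
  "splits p M B \<longleftrightarrow>
     B \<subseteq> carrier (Zp p) \<and>
     (\<forall>g \<in> carrier (Zp p) - {\<zero>\<^bsub>Zp p\<^esub>}.
        \<exists>!(m, b). m \<in> M \<and> b \<in> B \<and> g = zp p m \<otimes>\<^bsub>Zp p\<^esub> b) \<and>
     \<not> (\<exists>m \<in> M. \<exists>b \<in> B. \<zero>\<^bsub>Zp p\<^esub> = zp p m \<otimes>\<^bsub>Zp p\<^esub> b)"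

end

theory Submission
  imports Defs
begin

text \<open>Write \<open>G\<close> for the ambient group and \<open>T\<close> for the splitter set. Up to sign, a nonzero
  element lies either in \<open>T\<close> or in exactly two of \<open>2T\<close>, \<open>4T\<close>, \<open>3T\<close>, \<open>5T\<close>. Hence the six sets
  \<open>\<plusminus>T\<close>, \<open>\<plusminus>2T\<close>, \<open>\<plusminus>4T\<close> are disjoint, and since \<open>|G| = 6|T|\<close> they partition \<open>G\<close>; so \<open>8t\<close> or
  \<open>-8t\<close> is in \<open>T\<close> for each \<open>t \<in> T\<close>. Looking at how \<open>-2t\<close> and \<open>-4t\<close> are covered, one of the pairs
  \<open>{-(2/5)t, -(4/3)t}\<close> and \<open>{-(2/3)t, -(4/5)t}\<close> lies in \<open>T\<close>. Which pair it is cannot change along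
  multiplication by these fractions or by \<open>\<plusminus>8\<close>, which determines \<open>T\<close> on a coset of
  \<open>\<langle>-1, 2, 3, 5\<rangle>\<close>.\<close>

section \<open>Subgroups generated in a finite group\<close>

context group
begin

lemma inv_eq_nat_pow:
  assumes "finite (carrier G)" "x \<in> carrier G"
  shows "inv x = x [^] (order G - 1)"
proof (rule inv_equality)
  have "order G > 0"
    using assms order_gt_0_iff_finite by blast
  then have "x [^] (order G - 1) \<otimes> x = x [^] order G"
    by (metis Suc_diff_1 nat_pow_Suc)
  then show "x [^] (order G - 1) \<otimes> x = \<one>"
    using assms pow_order_eq_1 by simp
qed (use assms in auto)

text \<open>By \<open>inv_eq_nat_pow\<close> an inverse is a natural power, so closure under
  products gives closure under inverses for free. This is why later arguments only ever step forward
  along generators.\<close>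

lemma generate_subset_if_closed:
  assumes fin: "finite (carrier G)" and S: "S \<subseteq> carrier G"
    and D: "\<one> \<in> D" "S \<subseteq> D" "\<And>x y. \<lbrakk>x \<in> D; y \<in> D\<rbrakk> \<Longrightarrow> x \<otimes> y \<in> D"
  shows "generate G S \<subseteq> D"
proof
  fix x assume "x \<in> generate G S"
  then show "x \<in> D"
  proof (induction rule: generate.induct)
    case (inv x)
    have "x [^] (n::nat) \<in> D" for n
      by (induction n) (use inv D in auto)
    then show ?case
      using inv_eq_nat_pow[OF fin] inv S by auto
  qed (use D in auto)
qed

end

section \<open>Tilings of a finite abelian group, modelled on s = -1, a = 2, b = 3, c = 5\<close>

locale signed_tiling = comm_group G for G (structure) +
  fixes s a b c :: 'a and T :: "'a set"
  assumes fin: "finite (carrier G)"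
    and closed [simp]: "s \<in> carrier G" "a \<in> carrier G" "b \<in> carrier G" "c \<in> carrier G"
    and T_sub: "T \<subseteq> carrier G"
    and s_square: "s \<otimes> s = \<one>"
    and distinct: "distinct [\<one>, s, a, a \<otimes> a, b, c]"
    and tiling: "bij_betw (\<lambda>(m, t). m \<otimes> t) ({\<one>, s, a, a \<otimes> a, b, c} \<times> T) (carrier G)"
begin

abbreviation "M \<equiv> {\<one>, s, a, a \<otimes> a, b, c}"

lemma T_closed [simp]: "t \<in> T \<Longrightarrow> t \<in> carrier G"
  using T_sub by auto

lemma s_cancel [simp]: "x \<in> carrier G \<Longrightarrow> s \<otimes> (s \<otimes> x) = x"
  by (simp flip: m_assoc add: s_square)

lemma unique:
  assumes "m \<otimes> t = m' \<otimes> t'" "m \<in> M" "m' \<in> M" "t \<in> T" "t' \<in> T"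
  shows "m = m' \<and> t = t'"
  using inj_onD[OF bij_betw_imp_inj_on[OF tiling], of "(m, t)" "(m', t')"] assms by auto

lemma covered:
  assumes "g \<in> carrier G"
  obtains m t where "m \<in> M" "t \<in> T" "g = m \<otimes> t"
proof -
  have "g \<in> (\<lambda>(m, t). m \<otimes> t) ` (M \<times> T)"
    using tiling assms by (simp only: bij_betw_def)
  then obtain q where "q \<in> M \<times> T" "g = (\<lambda>(m, t). m \<otimes> t) q"
    by (rule imageE)
  then show thesis
    using that[of "fst q" "snd q"] by (simp only: mem_Times_iff case_prod_beta)
qed

lemma not_neg:
  assumes "t \<in> T" shows "s \<otimes> t \<notin> T"
  using unique[of \<one> "s \<otimes> t" s t] distinct assms by auto

text \<open>Since \<open>e\<close> is its own inverse, e(mt) = u with u in \<open>T\<close> would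
  give mt = eu: one element with two representations, as \<open>m\<close> is a or a^2 while
  \<open>e\<close> is 1 or s. So \<open>T\<close> avoids both signs of aT and of a^2 T.\<close>

lemma separated:
  assumes "t \<in> T" "e = \<one> \<or> e = s"
  shows "e \<otimes> (a \<otimes> t) \<notin> T" "e \<otimes> (a \<otimes> (a \<otimes> t)) \<notin> T"
proof -
  have *: "e \<otimes> (m \<otimes> t) \<notin> T" if m: "m = a \<or> m = a \<otimes> a" for m
  proof
    assume T: "e \<otimes> (m \<otimes> t) \<in> T"
    have "m \<in> carrier G"
      using m by auto
    then have "e \<otimes> (e \<otimes> (m \<otimes> t)) = m \<otimes> t"
      using assms by auto
    moreover have "e \<in> M" "m \<in> M"
      using assms(2) m by auto
    ultimately have "e = m"
      using unique T assms(1) by blast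
    then show False
      using assms(2) m distinct by auto
  qed
  show "e \<otimes> (a \<otimes> t) \<notin> T" "e \<otimes> (a \<otimes> (a \<otimes> t)) \<notin> T"
    using *[of a] *[of "a \<otimes> a"] assms(1) by (simp_all add: m_assoc)
qed

lemma sign_move:
  assumes "e = \<one> \<or> e = s" "e' = \<one> \<or> e' = s" "x \<in> carrier G" "y \<in> carrier G" "e \<otimes> x = e' \<otimes> y"
  shows "\<exists>d. (d = \<one> \<or> d = s) \<and> y = d \<otimes> x"
  using assms by (metis l_one s_cancel)

lemma card_T: "order G = 6 * card T"
proof -
  have "card M = 6"
    using distinct distinct_card[OF distinct] by simp
  then show ?thesis
    using bij_betw_same_card[OF tiling] by (simp add: order_def card_cartesian_product)
qed

text \<open>The sets ejT, with j among 1, a, a^2, are pairwise disjoint by \<open>separated\<close>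
  and \<open>not_neg\<close>, and each has as many elements as \<open>T\<close>. There are six of
  them, so \<open>card_T\<close> forces them to fill the group.\<close>

lemma six_layers:
  assumes "g \<in> carrier G"
  obtains e j t where "e = \<one> \<or> e = s" "j = \<one> \<or> j = a \<or> j = a \<otimes> a" "t \<in> T" "g = e \<otimes> (j \<otimes> t)"
proof -
  define f where "f = (\<lambda>((e, j), t). e \<otimes> (j \<otimes> t))"
  define D where "D = ({\<one>, s} \<times> {\<one>, a, a \<otimes> a}) \<times> T"
  have inj: "inj_on f D"
  proof (rule inj_onI)
    fix v v' assume "v \<in> D" "v' \<in> D" "f v = f v'"
    moreover obtain e j t e' j' t' where v: "v = ((e, j), t)" "v' = ((e', j'), t')"
      by (metis prod.collapse)
    ultimately have e: "e = \<one> \<or> e = s" "e' = \<one> \<or> e' = s"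
      and j: "j = \<one> \<or> j = a \<or> j = a \<otimes> a" "j' = \<one> \<or> j' = a \<or> j' = a \<otimes> a"
      and t: "t \<in> T" "t' \<in> T" and eq: "e \<otimes> (j \<otimes> t) = e' \<otimes> (j' \<otimes> t')"
      by (auto simp: f_def D_def)
    have jc: "j \<in> carrier G" "j' \<in> carrier G"
      using j by auto
    obtain d where d: "d = \<one> \<or> d = s" "j' \<otimes> t' = d \<otimes> (j \<otimes> t)"
      using sign_move[OF e _ _ eq] jc t by auto
    have dc: "d \<in> carrier G"
      using d by auto
    obtain d' where d': "d' = \<one> \<or> d' = s" "j \<otimes> t = d' \<otimes> (j' \<otimes> t')"
      using sign_move[OF e(2,1) _ _ eq[symmetric]] jc t by auto
    have d'c: "d' \<in> carrier G"
      using d' by auto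
    \<comment> \<open>If the exponents of a differ, cancelling the lower power puts an element of
      \<open>T\<close> into a signed copy of aT or a^2 T. Both \<open>d\<close> and
      \<open>d'\<close> are at hand so that either side can carry the higher power.\<close>
    have "j = j'"
    proof (rule ccontr)
      assume "j \<noteq> j'"
      then consider "j' = \<one>" "j = a" | "j' = \<one>" "j = a \<otimes> a" | "j' = a" "j = a \<otimes> a"
        | "j = \<one>" "j' = a" | "j = \<one>" "j' = a \<otimes> a" | "j = a" "j' = a \<otimes> a"
        using j by blast
      then show False
      proof cases
        case 3
        then have "a \<otimes> t' = a \<otimes> (d \<otimes> (a \<otimes> t))"
          using d dc t by (simp add: m_ac)
        then show False
          using separated(1)[OF t(1) d(1)] t dc by simp
      next
        case 6
        then have "a \<otimes> t = a \<otimes> (d' \<otimes> (a \<otimes> t'))"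
          using d' d'c t by (simp add: m_ac)
        then show False
          using separated(1)[OF t(2) d'(1)] t d'c by simp
      next
        case 1
        then show False
          using d(2) separated(1)[OF t(1) d(1)] t by auto
      next
        case 2
        then show False
          using d(2) separated(2)[OF t(1) d(1)] t by (auto simp: m_assoc)
      next
        case 4
        then show False
          using d'(2) separated(1)[OF t(2) d'(1)] t by auto
      next
        case 5
        then show False
          using d'(2) separated(2)[OF t(2) d'(1)] t by (auto simp: m_assoc)
      qed
    qed
    then have "j \<otimes> t' = j \<otimes> (d \<otimes> t)"
      using d dc jc t by (simp add: m_ac)
    then have "t' = d \<otimes> t"
      using jc dc t by simp
    then have "t' = t"
      using d t not_neg by auto
    moreover have "e = e'"
      using eq e jc t \<open>j = j'\<close> \<open>t' = t\<close>
      by (metis T_closed closed(1) m_closed one_closed right_cancel)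
    ultimately show "v = v'"
      using \<open>j = j'\<close> v by simp
  qed
  have finT: "finite T"
    using fin T_sub finite_subset by blast
  have "card {\<one>, s} = 2" "card {\<one>, a, a \<otimes> a} = 3"
    using distinct by auto
  then have "card D = 6 * card T"
    unfolding D_def by (simp only: card_cartesian_product)
  then have "card (f ` D) = card (carrier G)"
    using card_T inj by (simp add: card_image order_def)
  moreover have "f ` D \<subseteq> carrier G"
    by (auto simp: f_def D_def)
  ultimately have "f ` D = carrier G"
    using fin by (simp add: card_subset_eq)
  with assms obtain v where v: "v \<in> D" "g = f v"
    by blast
  obtain e j t where "v = ((e, j), t)"
    by (metis prod.collapse)
  with v show thesis
    using that[of e j t] by (simp add: f_def D_def del: insert_iff) auto
qed

text \<open>In \<open>six_layers\<close> for a^3 t, the layer j = a would put a^2 t in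
  \<open>T\<close> up to sign, and j = a^2 would do so with at. Both contradict
  \<open>separated\<close>, leaving j = 1.\<close>

lemma cube_shift:
  assumes "t \<in> T"
  obtains e where "e = \<one> \<or> e = s" "e \<otimes> (a \<otimes> (a \<otimes> (a \<otimes> t))) \<in> T"
proof -
  obtain e j u where eju: "e = \<one> \<or> e = s" "j = \<one> \<or> j = a \<or> j = a \<otimes> a" "u \<in> T"
      "a \<otimes> (a \<otimes> (a \<otimes> t)) = e \<otimes> (j \<otimes> u)"
    using six_layers[of "a \<otimes> (a \<otimes> (a \<otimes> t))"] assms by auto
  have ec: "e \<in> carrier G"
    using eju by auto
  have [simp]: "e \<otimes> (e \<otimes> x) = x" if "x \<in> carrier G" for x
    using eju(1) that by auto
  from eju(2) show thesis
  proof (elim disjE)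
    assume "j = \<one>"
    then show thesis
      using that[OF eju(1)] eju ec by simp
  next
    assume "j = a"
    then have "a \<otimes> (a \<otimes> (a \<otimes> t)) = a \<otimes> (e \<otimes> u)"
      using eju ec by (simp add: m_ac)
    then have "a \<otimes> (a \<otimes> t) = e \<otimes> u"
      using eju(3) ec assms by simp
    then have "e \<otimes> (a \<otimes> (a \<otimes> t)) = u"
      using eju(3) by simp
    then show thesis
      using separated[OF assms eju(1)] eju(3) by simp
  next
    assume "j = a \<otimes> a"
    then have "a \<otimes> (a \<otimes> (a \<otimes> t)) = a \<otimes> (a \<otimes> (e \<otimes> u))"
      using eju ec by (simp add: m_ac)
    then have "a \<otimes> t = e \<otimes> u"
      using eju(3) ec assms by simp
    then have "e \<otimes> (a \<otimes> t) = u"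
      using eju(3) by simp
    then show thesis
      using separated[OF assms eju(1)] eju(3) by simp
  qed
qed

section \<open>The two types of elements of T; the quotients model -2/5, -4/3, -2/3, -4/5 in this
  order\<close>

definition h where "h = s \<otimes> a \<otimes> inv c"
definition k where "k = s \<otimes> (a \<otimes> a) \<otimes> inv b"
definition h' where "h' = s \<otimes> a \<otimes> inv b"
definition k' where "k' = s \<otimes> (a \<otimes> a) \<otimes> inv c"

lemma hk_closed [simp]:
  "h \<in> carrier G" "k \<in> carrier G" "h' \<in> carrier G" "k' \<in> carrier G"
  by (simp_all add: h_def k_def h'_def k'_def)

definition type1 where "type1 t \<longleftrightarrow> t \<in> T \<and> t \<otimes> h \<in> T \<and> t \<otimes> k \<in> T"
definition type2 where "type2 t \<longleftrightarrow> t \<in> T \<and> t \<otimes> h' \<in> T \<and> t \<otimes> k' \<in> T"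

lemma solve_factor:
  assumes "x \<in> carrier G" "u \<in> carrier G" "y \<in> carrier G" "x = y \<otimes> u"
  shows "x \<otimes> inv y = u"
  using assms by (metis inv_solve_right' m_closed m_comm)

text \<open>The elements s a t and s a^2 t must be covered using b or c, since the other multipliers
  contradict \<open>separated\<close> or \<open>not_neg\<close>. The first puts th' or th in
  \<open>T\<close>, the second tk or tk'. Because k = ah' and k' = ah, the mixed pairs would differ
  by a factor a, so only the pairs (h, k) and (h', k') survive.\<close>

lemma type_cases:
  assumes t: "t \<in> T"
  shows "type1 t \<or> type2 t"
proof -
  have sep: "a \<otimes> t \<notin> T" "s \<otimes> (a \<otimes> t) \<notin> T" "a \<otimes> (a \<otimes> t) \<notin> T" "s \<otimes> (a \<otimes> (a \<otimes> t)) \<notin> T"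
    using separated[OF t, of \<one>] separated[OF t, of s] t by auto
  have 1: "t \<otimes> h' \<in> T \<or> t \<otimes> h \<in> T"
  proof -
    obtain m u where mu: "m \<in> M" "u \<in> T" "s \<otimes> (a \<otimes> t) = m \<otimes> u"
      using covered[of "s \<otimes> (a \<otimes> t)"] t by auto
    have "m \<noteq> \<one>" using mu(2,3) sep t by (metis T_closed l_one)
    moreover have "m \<noteq> s" using mu sep t by auto
    moreover have False if "m = a"
    proof -
      have "a \<otimes> (s \<otimes> t) = a \<otimes> u"
        using mu that t by (simp add: m_ac)
      then show False
        using mu t not_neg by auto
    qed
    moreover have False if "m = a \<otimes> a"
    proof -
      have "a \<otimes> t = a \<otimes> (s \<otimes> (a \<otimes> u))"
        using mu that t s_cancel[of "a \<otimes> t"] by (simp add: m_ac)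
      then show False
        using mu t separated[OF mu(2), of s] by auto
    qed
    ultimately consider "m = b" | "m = c"
      using mu by auto
    then show ?thesis
    proof cases
      case 1
      then have "s \<otimes> (a \<otimes> t) \<otimes> inv b = u"
        using mu t by (intro solve_factor) auto
      then show ?thesis using mu(2) t by (simp add: h'_def m_ac)
    next
      case 2
      then have "s \<otimes> (a \<otimes> t) \<otimes> inv c = u"
        using mu t by (intro solve_factor) auto
      then show ?thesis using mu(2) t by (simp add: h_def m_ac)
    qed
  qed
  have 2: "t \<otimes> k \<in> T \<or> t \<otimes> k' \<in> T"
  proof -
    obtain m u where mu: "m \<in> M" "u \<in> T" "s \<otimes> (a \<otimes> (a \<otimes> t)) = m \<otimes> u"
      using covered[of "s \<otimes> (a \<otimes> (a \<otimes> t))"] t by auto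
    have "m \<noteq> \<one>" using mu(2,3) sep t by (metis T_closed l_one)
    moreover have "m \<noteq> s" using mu sep t by auto
    moreover have False if "m = a"
    proof -
      have "a \<otimes> (s \<otimes> (a \<otimes> t)) = a \<otimes> u"
        using mu that t by (simp add: m_ac)
      then show False
        using mu t sep by auto
    qed
    moreover have False if "m = a \<otimes> a"
    proof -
      have "a \<otimes> (a \<otimes> (s \<otimes> t)) = a \<otimes> (a \<otimes> u)"
        using mu that t by (simp add: m_ac)
      then show False
        using mu t not_neg by auto
    qed
    ultimately consider "m = b" | "m = c"
      using mu by auto
    then show ?thesis
    proof cases
      case 1
      then have "s \<otimes> (a \<otimes> (a \<otimes> t)) \<otimes> inv b = u"
        using mu t by (intro solve_factor) auto
      then show ?thesis using mu(2) t by (simp add: k_def m_ac)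
    next
      case 2
      then have "s \<otimes> (a \<otimes> (a \<otimes> t)) \<otimes> inv c = u"
        using mu t by (intro solve_factor) auto
      then show ?thesis using mu(2) t by (simp add: k'_def m_ac)
    qed
  qed
  have "t \<otimes> k = a \<otimes> (t \<otimes> h')" "t \<otimes> k' = a \<otimes> (t \<otimes> h)"
    using t by (simp_all add: h_def k_def h'_def k'_def m_ac)
  then have "\<not> (t \<otimes> h' \<in> T \<and> t \<otimes> k \<in> T)" "\<not> (t \<otimes> h \<in> T \<and> t \<otimes> k' \<in> T)"
    using separated(1)[of "t \<otimes> h'" \<one>] separated(1)[of "t \<otimes> h" \<one>] t by auto
  then show ?thesis
    using 1 2 t by (auto simp: type1_def type2_def)
qed

text \<open>If th had type 2, then u = thh' would lie in \<open>T\<close>. But tkh = au and tkk' =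
  a^2 u, so tk could have neither type. Hence th has type 1 and thk lies in \<open>T\<close>; then
  tkk' = a(thk) does not, which excludes type 2 for tk.\<close>

lemma type1_step:
  assumes "type1 t"
  shows "type1 (t \<otimes> h)" "type1 (t \<otimes> k)"
proof -
  have t: "t \<in> T" "t \<otimes> h \<in> T" "t \<otimes> k \<in> T"
    using assms by (auto simp: type1_def)
  have e1: "t \<otimes> k \<otimes> h = \<one> \<otimes> (a \<otimes> (t \<otimes> h \<otimes> h'))"
    and e2: "t \<otimes> k \<otimes> k' = \<one> \<otimes> (a \<otimes> (a \<otimes> (t \<otimes> h \<otimes> h')))"
    and e3: "t \<otimes> k \<otimes> k' = \<one> \<otimes> (a \<otimes> (t \<otimes> h \<otimes> k))"
    using t(1) by (simp_all add: h_def k_def h'_def k'_def m_ac)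
  have "\<not> type2 (t \<otimes> h)"
  proof
    assume "type2 (t \<otimes> h)"
    then have "t \<otimes> h \<otimes> h' \<in> T"
      by (simp add: type2_def)
    then have "t \<otimes> k \<otimes> h \<notin> T" "t \<otimes> k \<otimes> k' \<notin> T"
      unfolding e1 e2 using separated[of _ \<one>] by auto
    then show False
      using type_cases[OF t(3)] by (simp add: type1_def type2_def)
  qed
  then show 1: "type1 (t \<otimes> h)"
    using type_cases[OF t(2)] by simp
  then have "t \<otimes> k \<otimes> k' \<notin> T"
    unfolding e3 using separated(1)[of _ \<one>] by (auto simp: type1_def)
  then show "type1 (t \<otimes> k)"
    using type_cases[OF t(3)] by (auto simp: type2_def)
qed

text \<open>Type 2 at the shifted point would put e a^3 t h' in \<open>T\<close>. This equals e a^2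
  (tk), which \<open>separated\<close> excludes because tk is in \<open>T\<close>.\<close>

lemma type1_cube:
  assumes "type1 t"
  obtains e where "e = \<one> \<or> e = s" "type1 (e \<otimes> (a \<otimes> (a \<otimes> (a \<otimes> t))))"
proof -
  have t: "t \<in> T" "t \<otimes> k \<in> T"
    using assms by (auto simp: type1_def)
  obtain e where e: "e = \<one> \<or> e = s" and T: "e \<otimes> (a \<otimes> (a \<otimes> (a \<otimes> t))) \<in> T"
    using cube_shift[OF t(1)] by auto
  have ec: "e \<in> carrier G"
    using e by auto
  have "e \<otimes> (a \<otimes> (a \<otimes> (a \<otimes> t))) \<otimes> h' = e \<otimes> (a \<otimes> (a \<otimes> (t \<otimes> k)))"
    using t(1) ec by (simp add: k_def h'_def m_ac)
  then have "\<not> type2 (e \<otimes> (a \<otimes> (a \<otimes> (a \<otimes> t))))"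
    using separated(2)[OF t(2) e] by (simp add: type2_def)
  then show thesis
    using that e type_cases[OF T] by auto
qed

section \<open>The part of T in a coset of the subgroup generated by s, a, b, c\<close>

definition H where "H = generate G {h, k}"

lemma H_closed: "H \<subseteq> carrier G"
  unfolding H_def by (rule generate_incl) auto

lemma type1_H:
  assumes "type1 t" "\<eta> \<in> H"
  shows "type1 (t \<otimes> \<eta>)"
proof -
  \<comment> \<open>Quantifying over every \<open>t\<close> of type 1, not just the given one, is
    what makes this set closed under products.\<close>
  have "generate G {h, k} \<subseteq> {\<eta> \<in> carrier G. \<forall>t. type1 t \<longrightarrow> type1 (t \<otimes> \<eta>)}"
  proof (rule generate_subset_if_closed[OF fin])
    show "\<one> \<in> {\<eta> \<in> carrier G. \<forall>t. type1 t \<longrightarrow> type1 (t \<otimes> \<eta>)}"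
      by (auto simp: type1_def)
  next
    fix x y
    assume "x \<in> {\<eta> \<in> carrier G. \<forall>t. type1 t \<longrightarrow> type1 (t \<otimes> \<eta>)}"
      "y \<in> {\<eta> \<in> carrier G. \<forall>t. type1 t \<longrightarrow> type1 (t \<otimes> \<eta>)}"
    then show "x \<otimes> y \<in> {\<eta> \<in> carrier G. \<forall>t. type1 t \<longrightarrow> type1 (t \<otimes> \<eta>)}"
      by (auto simp flip: m_assoc simp: type1_def)
  qed (use type1_step in auto)
  then show ?thesis
    using assms by (auto simp: H_def)
qed

definition K where "K = generate G {s, a, b, c}"

lemma K_subgroup: "subgroup K G"
  unfolding K_def by (rule generate_is_subgroup) auto

text \<open>From the definitions, b = s a^2 / k and c = s a / h, so modulo \<open>H\<close> only a
  sign and a power of a remain. The exponent can be taken nonnegative because the group is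
  finite.\<close>

lemma K_decompose:
  assumes "x \<in> K"
  obtains e \<eta> and n :: nat where "e = \<one> \<or> e = s" "\<eta> \<in> H" "x = e \<otimes> (a [^] n \<otimes> \<eta>)"
proof -
  define E where "E = {e \<otimes> (a [^] n \<otimes> \<eta>) | e (n::nat) \<eta>. (e = \<one> \<or> e = s) \<and> \<eta> \<in> H}"
  have HE: "e \<otimes> (a [^] n \<otimes> \<eta>) \<in> E" if "e = \<one> \<or> e = s" "\<eta> \<in> H" for e \<eta> and n :: nat
    using that by (auto simp: E_def)
  have oneH: "\<one> \<in> H" "inv h \<in> H" "inv k \<in> H"
    unfolding H_def by (auto intro: generate.intros)
  have "K \<subseteq> E"
    unfolding K_def
  proof (rule generate_subset_if_closed[OF fin])
    show "\<one> \<in> E"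
      using HE[of \<one> \<one> 0] oneH by simp
    have b: "b = s \<otimes> (a [^] (2::nat) \<otimes> inv k)"
    proof -
      have "k \<otimes> b = s \<otimes> (a \<otimes> a)"
        by (simp add: k_def m_assoc)
      then have "b = inv k \<otimes> (s \<otimes> (a \<otimes> a))"
        by (metis closed(3) hk_closed(2) inv_closed inv_solve_left m_closed closed(1,2))
      then show ?thesis
        by (simp add: m_ac numeral_2_eq_2)
    qed
    have c: "c = s \<otimes> (a [^] (1::nat) \<otimes> inv h)"
    proof -
      have "h \<otimes> c = s \<otimes> a"
        by (simp add: h_def m_assoc)
      then have "c = inv h \<otimes> (s \<otimes> a)"
        by (metis closed(4) hk_closed(1) inv_closed inv_solve_left m_closed closed(1,2))
      then show ?thesis
        by (simp add: m_ac)
    qed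
    have "s \<in> E" "a \<in> E" "b \<in> E" "c \<in> E"
      using HE[of s \<one> 0] HE[of \<one> \<one> 1] oneH HE[of s "inv k" 2] HE[of s "inv h" 1] b c by auto
    then show "{s, a, b, c} \<subseteq> E" by simp
  next
    fix x y assume "x \<in> E" "y \<in> E"
    then obtain e n \<eta> e' n' \<eta>' where xy: "x = e \<otimes> (a [^] (n::nat) \<otimes> \<eta>)"
        "y = e' \<otimes> (a [^] (n'::nat) \<otimes> \<eta>')" "e = \<one> \<or> e = s" "\<eta> \<in> H" "e' = \<one> \<or> e' = s" "\<eta>' \<in> H"
      by (auto simp: E_def)
    then have cl: "e \<in> carrier G" "e' \<in> carrier G" "\<eta> \<in> carrier G" "\<eta>' \<in> carrier G"
      using H_closed by auto
    have "x \<otimes> y = (e \<otimes> e') \<otimes> (a [^] (n + n') \<otimes> (\<eta> \<otimes> \<eta>'))"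
      using xy cl by (simp add: m_ac flip: nat_pow_mult)
    moreover have "e \<otimes> e' = \<one> \<or> e \<otimes> e' = s" "\<eta> \<otimes> \<eta>' \<in> H"
      using xy s_square by (auto simp: H_def intro: generate.eng)
    ultimately show "x \<otimes> y \<in> E"
      using HE by simp
  qed auto
  then show thesis
    using assms that by (auto simp: E_def)
qed

text \<open>Repeated use of \<open>type1_cube\<close> supplies the signs, and \<open>type1_H\<close>
  then gives one inclusion. For the other, an element of the coset differs from a listed one by a
  sign and by a^r with r < 3, and the tiling forces it to be that listed element.\<close>

lemma type1_class:
  assumes x: "type1 x"
  shows "\<exists>e :: nat \<Rightarrow> 'a. (\<forall>n. e n = \<one> \<or> e n = s) \<and>
    T \<inter> (x <# K) = x <# (\<Union>n. (e n \<otimes> (a [^] (3::nat)) [^] n) <# H)"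
proof -
  have xT: "x \<in> T" and xc [simp]: "x \<in> carrier G"
    using x by (auto simp: type1_def)
  \<comment> \<open>The sign for the next exponent is the product of the old sign with the one from
    \<open>type1_cube\<close>. Only existence for each \<open>n\<close> is needed, as a sequence is
    chosen afterwards.\<close>
  have "\<exists>e. (e = \<one> \<or> e = s) \<and> type1 (e \<otimes> ((a [^] (3::nat)) [^] n \<otimes> x))" for n :: nat
  proof (induction n)
    case 0
    show ?case
      using x by (intro exI[of _ \<one>]) simp
  next
    case (Suc n)
    then obtain e where e: "e = \<one> \<or> e = s" "type1 (e \<otimes> ((a [^] (3::nat)) [^] n \<otimes> x))"
      by auto
    obtain d where d: "d = \<one> \<or> d = s"
        "type1 (d \<otimes> (a \<otimes> (a \<otimes> (a \<otimes> (e \<otimes> ((a [^] (3::nat)) [^] n \<otimes> x))))))"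
      using type1_cube[OF e(2)] by auto
    have "e \<in> carrier G" "d \<in> carrier G"
      using e d by auto
    then have "d \<otimes> (a \<otimes> (a \<otimes> (a \<otimes> (e \<otimes> ((a [^] (3::nat)) [^] n \<otimes> x))))) =
        (d \<otimes> e) \<otimes> ((a [^] (3::nat)) [^] Suc n \<otimes> x)"
      by (simp add: m_ac numeral_3_eq_3)
    moreover have "d \<otimes> e = \<one> \<or> d \<otimes> e = s"
      using d e s_square by auto
    ultimately show ?case
      using d by metis
  qed
  then obtain e where e: "\<And>n::nat. e n = \<one> \<or> e n = s"
      and te: "\<And>n. type1 (e n \<otimes> ((a [^] (3::nat)) [^] n \<otimes> x))"
    by metis
  have ec [simp]: "e n \<in> carrier G" for n
    using e[of n] by (metis closed(1) one_closed)
  have Hc [simp]: "\<eta> \<in> carrier G" if "\<eta> \<in> H" for \<eta>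
    using H_closed that by auto
  have eT: "e n \<otimes> ((a [^] (3::nat)) [^] n \<otimes> (x \<otimes> \<eta>)) \<in> T" if "\<eta> \<in> H" for n \<eta>
    using type1_H[OF te that] that by (simp add: type1_def m_assoc)
  have HK: "H \<subseteq> K"
  proof -
    interpret K: subgroup K G by (rule K_subgroup)
    have g: "s \<in> K" "a \<in> K" "b \<in> K" "c \<in> K"
      unfolding K_def by (auto intro: generate.incl)
    then have "h \<in> K" "k \<in> K"
      by (simp_all add: h_def k_def)
    then show ?thesis
      unfolding H_def using generate_subgroup_incl[OF _ K_subgroup] by simp
  qed
  have "T \<inter> (x <# K) = x <# (\<Union>n. (e n \<otimes> (a [^] (3::nat)) [^] n) <# H)" (is "_ = ?R")
  proof
    show "T \<inter> (x <# K) \<subseteq> ?R"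
    proof
      fix y assume "y \<in> T \<inter> (x <# K)"
      then obtain z where y: "y \<in> T" "z \<in> K" "y = x \<otimes> z"
        by (auto simp: l_coset_def)
      obtain d \<eta> and n :: nat where z: "d = \<one> \<or> d = s" "\<eta> \<in> H" "z = d \<otimes> (a [^] n \<otimes> \<eta>)"
        using K_decompose[OF y(2)] by auto
      have dc [simp]: "d \<in> carrier G"
        using z by auto
      \<comment> \<open>The exponent is split as 3q + r, and \<open>t\<close> is the listed element
        with the same \<open>q\<close> and \<open>\<eta>\<close>. Then y = d' a^r t, where
        \<open>separated\<close> rules out r = 1 and r = 2, and \<open>not_neg\<close> removes the
        sign when r = 0.\<close>
      define q where "q = n div 3"
      define t where "t = e q \<otimes> ((a [^] (3::nat)) [^] q \<otimes> (x \<otimes> \<eta>))"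
      have t: "t \<in> T"
        unfolding t_def using eT z by simp
      have an: "a [^] n = a [^] (n mod 3) \<otimes> (a [^] (3::nat)) [^] q"
        by (simp add: nat_pow_pow nat_pow_mult q_def)
      define d' where "d' = d \<otimes> e q"
      have d': "d' = \<one> \<or> d' = s"
        using e[of q] z s_square by (auto simp: d'_def)
      have d'c [simp]: "d' \<in> carrier G"
        using d' by auto
      \<comment> \<open>The sign inside \<open>t\<close> is its own inverse, so it cancels against
        the copy of \<open>e q\<close> in \<open>d'\<close>.\<close>
      have [simp]: "e q \<otimes> (e q \<otimes> w) = w" if "w \<in> carrier G" for w
        using e[of q] that by (metis l_one s_cancel)
      have yt: "y = d' \<otimes> (a [^] (n mod 3) \<otimes> t)"
        unfolding y(3) z(3) an t_def d'_def using z(2) by (simp add: m_ac)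
      have "n mod 3 = 0 \<or> n mod 3 = 1 \<or> n mod 3 = 2"
        by linarith
      then have "n mod 3 = 0"
      proof (elim disjE)
        assume "n mod 3 = 1"
        then have "y = d' \<otimes> (a \<otimes> t)"
          using yt by simp
        then show ?thesis
          using separated(1)[OF t d'] y by simp
      next
        assume "n mod 3 = 2"
        then have "y = d' \<otimes> (a \<otimes> (a \<otimes> t))"
          using yt t by (simp add: numeral_2_eq_2 m_ac)
        then show ?thesis
          using separated(2)[OF t d'] y by simp
      qed
      then have "y = t"
        using yt d' not_neg t y(1) by auto
      then have "y = x \<otimes> (e q \<otimes> (a [^] (3::nat)) [^] q \<otimes> \<eta>)"
        unfolding t_def using z(2) by (simp add: m_ac)
      then show "y \<in> ?R"
        using z(2) by (auto simp: l_coset_def)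
    qed
  next
    show "?R \<subseteq> T \<inter> (x <# K)"
    proof
      fix y assume "y \<in> ?R"
      then obtain n \<eta> where y: "\<eta> \<in> H" "y = x \<otimes> (e n \<otimes> (a [^] (3::nat)) [^] n \<otimes> \<eta>)"
        by (auto simp: l_coset_def)
      have "y = e n \<otimes> ((a [^] (3::nat)) [^] n \<otimes> (x \<otimes> \<eta>))"
        using y by (simp add: m_ac)
      then have "y \<in> T"
        using eT y by simp
      moreover have "e n \<otimes> (a [^] (3::nat)) [^] n \<otimes> \<eta> \<in> K"
      proof -
        interpret K: subgroup K G by (rule K_subgroup)
        have g: "s \<in> K" "a \<in> K"
          unfolding K_def by (auto intro: generate.incl)
        have pow: "z [^] (i::nat) \<in> K" if "z \<in> K" for z i
          by (induction i) (use that in auto)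
        have "e n \<in> K"
          using e[of n] g by auto
        then show ?thesis
          using pow[OF pow[OF g(2)]] HK y by auto
      qed
      ultimately show "y \<in> T \<inter> (x <# K)"
        using y by (auto simp: l_coset_def)
    qed
  qed
  then show ?thesis
    using e by blast
qed

end

text \<open>Exchanging b and c turns the pair (h, k) into (h', k'). Everything proved for type 1
  thus transfers to type 2.\<close>

lemma (in signed_tiling) swap: "signed_tiling G s a c b T"
proof unfold_locales
  have "{\<one>, s, a, a \<otimes> a, c, b} = M"
    by auto
  then show "bij_betw (\<lambda>(m, t). m \<otimes> t) ({\<one>, s, a, a \<otimes> a, c, b} \<times> T) (carrier G)"
    using tiling by simp
qed (use fin T_sub s_square distinct in auto)

theorem (in signed_tiling) tiling_class:
  assumes "x \<in> T"
  shows "\<exists>H \<in> {generate G {s \<otimes> a \<otimes> inv c, s \<otimes> (a \<otimes> a) \<otimes> inv b},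
      generate G {s \<otimes> (a \<otimes> a) \<otimes> inv c, s \<otimes> a \<otimes> inv b}}.
    \<exists>e :: nat \<Rightarrow> 'a. (\<forall>n. e n = \<one> \<or> e n = s) \<and>
      T \<inter> (x <# generate G {s, a, b, c}) =
        x <# (\<Union>n. (e n \<otimes> (a [^] (3::nat)) [^] n) <# H)"
proof -
  interpret sw: signed_tiling G s a c b T
    by (rule swap)
  have sets: "{s, a, c, b} = {s, a, b, c}" "{h', k'} = {k', h'}"
    by auto
  have hk: "sw.h = h'" "sw.k = k'"
    by (simp_all add: sw.h_def sw.k_def h'_def k'_def)
  from type_cases[OF assms] show ?thesis
  proof
    assume "type1 x"
    then show ?thesis
      using type1_class by (simp add: H_def K_def h_def k_def)
  next
    assume "type2 x"
    then have "sw.type1 x"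
      by (simp add: sw.type1_def type2_def hk)
    from sw.type1_class[OF this] show ?thesis
      by (simp only: sw.H_def sw.K_def hk sets) (simp add: h'_def k'_def)
  qed
qed

text \<open>Any unit multiple of a splitter set is again one, so a base point has to be fixed. At k
  = 0 the formulas without a leading factor contain 1 or -1, hence the condition on B there; every c
  in B1 gives the formula with factor c. Such c exist: writing 1 = mb shows that the inverse of m is
  in B1.\<close>

theorem theorem4p3:
  fixes p :: nat and B B1 H1 H2 :: "int set"
  assumes "prime p" and "[p = 1] (mod 6)"
    and "splits p {-1, 1, 2, 3, 4, 5} B"
    and "B1 = B \<inter> generate (Zp_units p) {zp p (-1), zp p 2, zp p 3, zp p 5}"
    and "H1 = generate (Zp_units p) {zp_frac p (-2) 5, zp_frac p (-4) 3}"
    and "H2 = generate (Zp_units p) {zp_frac p (-4) 5, zp_frac p (-2) 3}"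
  shows "(zp p 1 \<in> B \<or> zp p (-1) \<in> B \<longrightarrow>
      (\<exists>\<epsilon> :: nat \<Rightarrow> int. (\<forall>k. \<epsilon> k \<in> {1, -1}) \<and>
         B1 = (\<Union>k. zp p (\<epsilon> k * 8 ^ k) <#\<^bsub>Zp_units p\<^esub> H1)) \<or>
      (\<exists>\<epsilon> :: nat \<Rightarrow> int. (\<forall>k. \<epsilon> k \<in> {1, -1}) \<and>
         B1 = (\<Union>k. zp p (\<epsilon> k * 8 ^ k) <#\<^bsub>Zp_units p\<^esub> H2))) \<and>
    (\<forall>c \<in> B1.
      (\<exists>\<epsilon> :: nat \<Rightarrow> int. (\<forall>k. \<epsilon> k \<in> {1, -1}) \<and>
         B1 = c <#\<^bsub>Zp_units p\<^esub> (\<Union>k. zp p (\<epsilon> k * 8 ^ k) <#\<^bsub>Zp_units p\<^esub> H1)) \<or>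
      (\<exists>\<epsilon> :: nat \<Rightarrow> int. (\<forall>k. \<epsilon> k \<in> {1, -1}) \<and>
         B1 = c <#\<^bsub>Zp_units p\<^esub> (\<Union>k. zp p (\<epsilon> k * 8 ^ k) <#\<^bsub>Zp_units p\<^esub> H2)))"
proof -
  have "p mod 6 = 1"
    using assms(2) by (simp add: cong_def)
  moreover have "p > 1"
    using assms(1) prime_gt_1_nat by simp
  \<comment> \<open>This bound makes -1, 1, 2, 3, 4, 5 nonzero and pairwise distinct modulo p; for p
    = 7 they are exactly the nonzero residues.\<close>
  ultimately have p7: "p \<ge> 7"
    by presburger
  interpret R: residues_prime p "Zp p"
    by unfold_locales (use assms in auto)
  define U where "U = Zp_units p"
  have carU: "carrier U = {1..int p - 1}"
    by (auto simp: U_def R.res_carrier_eq R.res_zero_eq)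
  have mulU: "x \<otimes>\<^bsub>U\<^esub> y = x * y mod int p" for x y
    by (simp add: U_def R.res_mult_eq)
  have oneU: "\<one>\<^bsub>U\<^esub> = zp p 1"
    using p7 by (simp add: U_def R.res_one_eq zp_def)
  interpret U: comm_group U
    unfolding U_def R.mult_of_is_Units by (rule R.units_comm_group)
  have zpmul: "zp p x \<otimes>\<^bsub>U\<^esub> zp p y = zp p (x * y)" for x y
    by (simp add: mulU zp_def mod_mult_eq)
  have zppow: "zp p x [^]\<^bsub>U\<^esub> n = zp p (x ^ n)" for x and n :: nat
    by (induction n) (simp_all add: oneU zpmul mult.commute)
  have zpU: "zp p x \<in> carrier U" if "x \<in> {-1, 1, 2, 3, 4, 5}" for x
    using that p7 by (auto simp: carU zp_def zmod_minus1)
  have zpinj: "x = y" if "zp p x = zp p y" "x \<in> {-1, 1, 2, 3, 4, 5}" "y \<in> {-1, 1, 2, 3, 4, 5}" for x y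
    using that p7 by (auto simp: zp_def zmod_minus1)
  have B: "B \<subseteq> carrier U"
  proof
    fix b assume "b \<in> B"
    moreover from this have "b \<noteq> 0"
      using assms(3) by (auto simp: splits_def R.res_zero_eq R.res_mult_eq)
    ultimately show "b \<in> carrier U"
      using assms(3) by (auto simp: splits_def U_def R.res_zero_eq)
  qed
  have rep: "\<exists>!(m, b). m \<in> {-1, 1, 2, 3, 4, 5} \<and> b \<in> B \<and> g = zp p m \<otimes>\<^bsub>U\<^esub> b"
    if "g \<in> carrier U" for g
    using assms(3) that by (simp add: splits_def U_def)
  \<comment> \<open>The residue of 4 is rewritten as the square of that of 2, matching the shape of
    the multiplier set in \<open>signed_tiling\<close>.\<close>
  have img: "zp p ` {-1, 1, 2, 3, 4, 5} =
      {\<one>\<^bsub>U\<^esub>, zp p (-1), zp p 2, zp p 2 \<otimes>\<^bsub>U\<^esub> zp p 2, zp p 3, zp p 5}"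
    by (auto simp: oneU zpmul)
  interpret T: signed_tiling U "zp p (-1)" "zp p 2" "zp p 3" "zp p 5" B
  proof unfold_locales
    show "bij_betw (\<lambda>(m, t). m \<otimes>\<^bsub>U\<^esub> t)
       ({\<one>\<^bsub>U\<^esub>, zp p (-1), zp p 2, zp p 2 \<otimes>\<^bsub>U\<^esub> zp p 2, zp p 3, zp p 5} \<times> B) (carrier U)"
      unfolding img[symmetric]
    proof (rule bij_betw_imageI)
      show "inj_on (\<lambda>(m, t). m \<otimes>\<^bsub>U\<^esub> t) (zp p ` {-1, 1, 2, 3, 4, 5} \<times> B)"
      proof (rule inj_onI, clarify)
        fix m t m' t'
        assume A: "m \<in> {-1, 1, 2, 3, 4, 5}" "m' \<in> {-1, 1, 2, 3, 4, 5}" "t \<in> B" "t' \<in> B"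
          "zp p m \<otimes>\<^bsub>U\<^esub> t = zp p m' \<otimes>\<^bsub>U\<^esub> t'"
        then have "zp p m \<otimes>\<^bsub>U\<^esub> t \<in> carrier U"
          using B zpU by auto
        from rep[OF this] have "(m, t) = (m', t')"
          using A by (elim ex1E) (metis (mono_tags, lifting) case_prod_conv)
        then show "zp p m = zp p m' \<and> t = t'" by simp
      qed
      show "(\<lambda>(m, t). m \<otimes>\<^bsub>U\<^esub> t) ` (zp p ` {-1, 1, 2, 3, 4, 5} \<times> B) = carrier U"
      proof
        show "(\<lambda>(m, t). m \<otimes>\<^bsub>U\<^esub> t) ` (zp p ` {-1, 1, 2, 3, 4, 5} \<times> B) \<subseteq> carrier U"
          using B zpU by (auto intro!: U.m_closed simp del: insert_iff)
        show "carrier U \<subseteq> (\<lambda>(m, t). m \<otimes>\<^bsub>U\<^esub> t) ` (zp p ` {-1, 1, 2, 3, 4, 5} \<times> B)"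
        proof
          fix g assume "g \<in> carrier U"
          from ex1_implies_ex[OF rep[OF this]] obtain m b
            where "m \<in> {-1, 1, 2, 3, 4, 5}" "b \<in> B" "g = zp p m \<otimes>\<^bsub>U\<^esub> b"
            by blast
          then show "g \<in> (\<lambda>(m, t). m \<otimes>\<^bsub>U\<^esub> t) ` (zp p ` {-1, 1, 2, 3, 4, 5} \<times> B)"
            by (intro image_eqI[of _ _ "(zp p m, b)"]) auto
        qed
      qed
    qed
    show "distinct [\<one>\<^bsub>U\<^esub>, zp p (-1), zp p 2, zp p 2 \<otimes>\<^bsub>U\<^esub> zp p 2, zp p 3, zp p 5]"
      using zpinj[of 1 "-1"] zpinj[of 1] zpinj[of "-1"] zpinj[of 2] zpinj[of 4] zpinj[of 3]
      by (fastforce simp: oneU zpmul)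
  qed (use B zpU in \<open>auto simp: carU zpmul oneU\<close>)
  define K where "K = generate U {zp p (-1), zp p 2, zp p 3, zp p 5}"
  have B1: "B1 = B \<inter> K"
    using assms(4) by (simp add: K_def U_def)
  have K: "subgroup K U"
    unfolding K_def using zpU by (intro U.generate_is_subgroup) auto
  have frac: "zp_frac p x y = zp p x \<otimes>\<^bsub>U\<^esub> inv\<^bsub>U\<^esub> zp p y" if "y \<in> {3, 5}" for x y
    using R.m_inv_mult_of[of "zp p y"] zpU[of y] that by (auto simp: zp_frac_def U_def)
  have H: "H1 = generate U {zp p (-1) \<otimes>\<^bsub>U\<^esub> zp p 2 \<otimes>\<^bsub>U\<^esub> inv\<^bsub>U\<^esub> zp p 5,
        zp p (-1) \<otimes>\<^bsub>U\<^esub> (zp p 2 \<otimes>\<^bsub>U\<^esub> zp p 2) \<otimes>\<^bsub>U\<^esub> inv\<^bsub>U\<^esub> zp p 3}"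
      "H2 = generate U {zp p (-1) \<otimes>\<^bsub>U\<^esub> (zp p 2 \<otimes>\<^bsub>U\<^esub> zp p 2) \<otimes>\<^bsub>U\<^esub> inv\<^bsub>U\<^esub> zp p 5,
        zp p (-1) \<otimes>\<^bsub>U\<^esub> zp p 2 \<otimes>\<^bsub>U\<^esub> inv\<^bsub>U\<^esub> zp p 3}"
    using assms(5,6) by (simp_all add: frac zpmul flip: U_def)
  have Hsub: "H1 \<subseteq> carrier U" "H2 \<subseteq> carrier U"
    unfolding H using zpU by (auto intro!: U.generate_incl)
  have main: "\<exists>H \<in> {H1, H2}. \<exists>\<epsilon> :: nat \<Rightarrow> int. (\<forall>k. \<epsilon> k \<in> {1, -1}) \<and>
      B1 = x <#\<^bsub>U\<^esub> (\<Union>k. zp p (\<epsilon> k * 8 ^ k) <#\<^bsub>U\<^esub> H)" if x: "x \<in> B1" for x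
  proof -
    have "x \<in> B"
      using x B1 by simp
    from T.tiling_class[OF this] obtain H e where He: "H \<in> {H1, H2}"
        "\<And>n::nat. e n = \<one>\<^bsub>U\<^esub> \<or> e n = zp p (-1)"
        "B \<inter> (x <#\<^bsub>U\<^esub> K) = x <#\<^bsub>U\<^esub> (\<Union>n. (e n \<otimes>\<^bsub>U\<^esub> (zp p 2 [^]\<^bsub>U\<^esub> (3::nat)) [^]\<^bsub>U\<^esub> n) <#\<^bsub>U\<^esub> H)"
      unfolding H[symmetric] K_def[symmetric] by blast
    \<comment> \<open>As x itself lies in K, its coset is K, and the description of B on that coset
      becomes one of B1.\<close>
    have "x <#\<^bsub>U\<^esub> K = K"
      using x B1 U.coset_join3 K subgroup.mem_carrier by fastforce
    moreover define \<epsilon> :: "nat \<Rightarrow> int" where "\<epsilon> n = (if e n = \<one>\<^bsub>U\<^esub> then 1 else -1)" for n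
    have "e n \<otimes>\<^bsub>U\<^esub> (zp p 2 [^]\<^bsub>U\<^esub> (3::nat)) [^]\<^bsub>U\<^esub> n = zp p (\<epsilon> n * 8 ^ n)" for n
    proof -
      have "e n = zp p (\<epsilon> n)"
        using He(2)[of n] by (auto simp: \<epsilon>_def oneU)
      then show ?thesis
        by (simp add: zppow zpmul)
    qed
    ultimately have "B1 = x <#\<^bsub>U\<^esub> (\<Union>k. zp p (\<epsilon> k * 8 ^ k) <#\<^bsub>U\<^esub> H)"
      using He(3) B1 by simp
    moreover have "\<forall>k. \<epsilon> k \<in> {1, -1}"
      by (simp add: \<epsilon>_def)
    ultimately show ?thesis
      using He(1) by blast
  qed
  \<comment> \<open>A leading factor 1 or -1 is absorbed by multiplying every sign by it.\<close>
  have sign: "\<exists>\<epsilon>' :: nat \<Rightarrow> int. (\<forall>k. \<epsilon>' k \<in> {1, -1}) \<and>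
      zp p d <#\<^bsub>U\<^esub> (\<Union>k. zp p (\<epsilon> k * 8 ^ k) <#\<^bsub>U\<^esub> H) = (\<Union>k. zp p (\<epsilon>' k * 8 ^ k) <#\<^bsub>U\<^esub> H)"
    if d: "d \<in> {1, -1}" and e: "\<forall>k. \<epsilon> k \<in> {1, -1}" and H: "H \<in> {H1, H2}" for d H and \<epsilon> :: "nat \<Rightarrow> int"
  proof (intro exI[of _ "\<lambda>k. d * \<epsilon> k"] conjI allI)
    show "d * \<epsilon> k \<in> {1, -1}" for k
      using d e[rule_format, of k] by auto
    \<comment> \<open>Membership in the unit group comes from writing 8 as 2^3, a power of a known
      unit.\<close>
    have "zp p (\<epsilon> k * 8 ^ k) \<in> carrier U" for k
    proof -
      have "zp p (\<epsilon> k) \<otimes>\<^bsub>U\<^esub> (zp p 2 [^]\<^bsub>U\<^esub> (3::nat)) [^]\<^bsub>U\<^esub> k \<in> carrier U"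
        using e[rule_format, of k] zpU by (intro U.m_closed U.nat_pow_closed) auto
      then show ?thesis
        by (simp add: zppow zpmul)
    qed
    then have "zp p d \<otimes>\<^bsub>U\<^esub> (zp p (\<epsilon> k * 8 ^ k) \<otimes>\<^bsub>U\<^esub> y) = zp p (d * \<epsilon> k * 8 ^ k) \<otimes>\<^bsub>U\<^esub> y"
      if "y \<in> H" for y k
      using that Hsub H d zpU[of d] by (subst U.m_assoc[symmetric]) (auto simp: zpmul mult.assoc)
    then show "zp p d <#\<^bsub>U\<^esub> (\<Union>k. zp p (\<epsilon> k * 8 ^ k) <#\<^bsub>U\<^esub> H) = (\<Union>k. zp p (d * \<epsilon> k * 8 ^ k) <#\<^bsub>U\<^esub> H)"
      by (auto simp: l_coset_def)
  qed
  have "\<exists>H \<in> {H1, H2}. \<exists>\<epsilon> :: nat \<Rightarrow> int. (\<forall>k. \<epsilon> k \<in> {1, -1}) \<and>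
      B1 = (\<Union>k. zp p (\<epsilon> k * 8 ^ k) <#\<^bsub>U\<^esub> H)" if "zp p 1 \<in> B \<or> zp p (-1) \<in> B"
  proof -
    \<comment> \<open>The base point is 1 or -1, which lies in K, so \<open>main\<close> applies to
      it and \<open>sign\<close> removes the resulting factor.\<close>
    obtain d where d: "d \<in> {1, -1}" "zp p d \<in> B"
      using \<open>zp p 1 \<in> B \<or> zp p (-1) \<in> B\<close> by blast
    have "zp p d \<in> K"
      using d subgroup.one_closed[OF K] by (auto simp: oneU K_def intro: generate.incl)
    then obtain H and \<epsilon> :: "nat \<Rightarrow> int" where H: "H \<in> {H1, H2}" and e: "\<forall>k. \<epsilon> k \<in> {1, -1}"
      and eq: "B1 = zp p d <#\<^bsub>U\<^esub> (\<Union>k. zp p (\<epsilon> k * 8 ^ k) <#\<^bsub>U\<^esub> H)"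
      using main[of "zp p d"] d(2) B1 by blast
    show ?thesis
      using sign[OF d(1) e H] H unfolding eq by blast
  qed
  then show ?thesis
    using main unfolding U_def[symmetric] by blast
qed

end
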